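(* Let $k_1,k_2$ be real constants and let $c\in\mathbb{R}$. The peaked function $$\varphi_c(t,x)=C_1e^{-|x-ct|},$$ where the constant $C_1$ (real or complex) satisfies $\frac13k_1C_1^2+\frac12k_2C_1+c=0$, is a global weak solution (with initial datum $\varphi_c(0,\cdot)$) of the equation $$m_t=\tfrac12 k_1\big((u^2-u_x^2)m\big)_x+\tfrac12 k_2\,(u m_x+2m u_x),\qquad m=u-u_{xx},\qquad x\in\mathbb{R}.$$ Moreover, for every time $t\ge0$, $\varphi_c(t,\cdot)$ belongs to $H^1\cap W^{1,\infty}$.
   Context: All function spaces are over $\mathbb{R}$. Let $p(x)=\frac12e^{-|x|}$, so that $(1-\partial_x^2)^{-1}f=p\ast f$ for $f\in L^2$, where $\ast$ is convolution in $x$. Weak solution: let $u_0\in W^{1,3}$. A function $u(t,x)\in L^\infty_{loc}([0,T);W^{1,3}_{loc})$ is called a weak solution on $[0,T)$ of the equation with initial datum $u_0$ if $$\int_0^T\!\!\int_{\mathbb{R}}\Big(u\phi_t-\tfrac16k_1u^3\phi_x-\tfrac16k_1u_x^3\phi-\tfrac14k_2u^2\phi_x-\tfrac12\,p\ast\big(k_1(uu_x^2+\tfrac23u^3)+k_2(u^2+\tfrac12u_x^2)\big)\phi_x+\tfrac16k_1(p\ast u_x^3)\phi\Big)dx\,dt+\int_{\mathbb{R}}u_0\,\phi(0,x)\,dx=0$$ for all $\phi\in C_c^\infty([0,T)\times\mathbb{R})$. If $u$ is a weak solution on $[0,T)$ for every $T>0$, it is called a global weak solution. *)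

theory Defs
  imports "HOL-Analysis.Analysis"
begin

text \<open>
  Functions are complex-valued because the amplitude of the peaked wave may be complex; powers of
  functions are plain (not modulus) powers. Elements of function spaces are represented by
  Lebesgue measurable functions.
\<close>

definition test_fun_line :: "(real \<Rightarrow> complex) \<Rightarrow> bool" where
  "test_fun_line \<psi> \<longleftrightarrow>
     (\<exists>D. D 0 = \<psi> \<and> (\<forall>n x. (D n has_vector_derivative D (Suc n) x) (at x))) \<and>
     (\<exists>K. compact K \<and> (\<forall>x. x \<notin> K \<longrightarrow> \<psi> x = 0))"

definition has_weak_deriv :: "(real \<Rightarrow> complex) \<Rightarrow> (real \<Rightarrow> complex) \<Rightarrow> bool" where
  "has_weak_deriv f g \<longleftrightarrow>
     (\<forall>K. compact K \<longrightarrow> set_integrable lebesgue K f \<and> set_integrable lebesgue K g) \<and>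
     (\<forall>\<psi>. test_fun_line \<psi> \<longrightarrow>
        (LINT x|lebesgue. f x * vector_derivative \<psi> (at x)) = - (LINT x|lebesgue. g x * \<psi> x))"

definition Lp :: "real \<Rightarrow> (real \<Rightarrow> complex) set" where
  "Lp q = {f \<in> borel_measurable lebesgue. integrable lebesgue (\<lambda>x. norm (f x) powr q)}"

definition Linfty :: "(real \<Rightarrow> complex) set" where
  "Linfty = {f \<in> borel_measurable lebesgue. \<exists>B. AE x in lebesgue. norm (f x) \<le> B}"

text \<open>The first-order Sobolev space over \<open>X\<close>: thus \<open>W1 (Lp q)\<close> is $W^{1,q}$,
  \<open>W1 Linfty\<close> is $W^{1,\infty}$, and \<open>W1 (Lp 2)\<close> is $H^1$.\<close>

definition W1 :: "(real \<Rightarrow> complex) set \<Rightarrow> (real \<Rightarrow> complex) set" where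
  "W1 X = {f \<in> X. \<exists>g\<in>X. has_weak_deriv f g}"

text \<open>\<open>Linfty_loc_W13_loc T u v\<close>: \<open>u\<close> belongs to $L^\infty_{loc}([0,T);W^{1,3}_{loc})$ and
  \<open>v\<close> represents its weak derivative in $x$ (which is unique up to null sets).\<close>

definition Linfty_loc_W13_loc ::
    "real \<Rightarrow> (real \<Rightarrow> real \<Rightarrow> complex) \<Rightarrow> (real \<Rightarrow> real \<Rightarrow> complex) \<Rightarrow> bool" where
  "Linfty_loc_W13_loc T u v \<longleftrightarrow>
     set_borel_measurable lebesgue ({0..<T} \<times> UNIV) (\<lambda>(t, x). u t x) \<and>
     set_borel_measurable lebesgue ({0..<T} \<times> UNIV) (\<lambda>(t, x). v t x) \<and>
     (AE t in lebesgue. t \<in> {0..<T} \<longrightarrow> has_weak_deriv (u t) (v t)) \<and>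
     (\<forall>S K. S < T \<longrightarrow> compact K \<longrightarrow>
        (\<exists>B. AE t in lebesgue. t \<in> {0..S} \<longrightarrow>
           set_integrable lebesgue K (\<lambda>x. norm (u t x) powr 3) \<and>
           set_integrable lebesgue K (\<lambda>x. norm (v t x) powr 3) \<and>
           (LINT x:K|lebesgue. norm (u t x) powr 3)
             + (LINT x:K|lebesgue. norm (v t x) powr 3) \<le> B))"

text \<open>$C_c^\infty([0,T)\times\mathbb{R})$: \<open>D i j\<close> is the mixed partial derivative of order
  \<open>i\<close> in $t$ and \<open>j\<close> in $x$. The derivatives in $t$ are one-sided at $t = 0$, where the test
  function need not vanish. Values for $t$ outside $[0,T)$ are irrelevant.\<close>

definition test_fun :: "real \<Rightarrow> (real \<Rightarrow> real \<Rightarrow> complex) \<Rightarrow> bool" where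
  "test_fun T \<phi> \<longleftrightarrow>
     (\<exists>D. D 0 0 = \<phi> \<and>
        (\<forall>i j. continuous_on ({0..<T} \<times> UNIV) (\<lambda>(t, x). D i j t x) \<and>
           (\<forall>t\<in>{0..<T}. \<forall>x.
              ((\<lambda>s. D i j s x) has_vector_derivative D (Suc i) j t x) (at t within {0..<T}) \<and>
              (D i j t has_vector_derivative D i (Suc j) t x) (at x)))) \<and>
     (\<exists>K. compact K \<and> K \<subseteq> {0..<T} \<times> UNIV \<and>
        (\<forall>t\<in>{0..<T}. \<forall>x. (t, x) \<notin> K \<longrightarrow> \<phi> t x = 0))"

definition kernel_p :: "real \<Rightarrow> real" where
  "kernel_p x = exp (- \<bar>x\<bar>) / 2"

definition p_conv :: "(real \<Rightarrow> complex) \<Rightarrow> real \<Rightarrow> complex" where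
  "p_conv f x = (LINT y|lebesgue. kernel_p (x - y) *\<^sub>R f y)"

definition p_conv_exists :: "(real \<Rightarrow> complex) \<Rightarrow> real \<Rightarrow> bool" where
  "p_conv_exists f x \<longleftrightarrow> integrable lebesgue (\<lambda>y. kernel_p (x - y) *\<^sub>R f y)"

definition nonlocal_term :: "real \<Rightarrow> real \<Rightarrow> complex \<Rightarrow> complex \<Rightarrow> complex" where
  "nonlocal_term k1 k2 w v =
     of_real k1 * (w * v\<^sup>2 + 2/3 * w ^ 3) + of_real k2 * (w\<^sup>2 + 1/2 * v\<^sup>2)"

definition weak_integrand ::
    "real \<Rightarrow> real \<Rightarrow> real \<Rightarrow> (real \<Rightarrow> real \<Rightarrow> complex) \<Rightarrow> (real \<Rightarrow> real \<Rightarrow> complex)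
      \<Rightarrow> (real \<Rightarrow> real \<Rightarrow> complex) \<Rightarrow> real \<Rightarrow> real \<Rightarrow> complex" where
  "weak_integrand k1 k2 T u v \<phi> t x =
     (let \<phi>\<^sub>t = vector_derivative (\<lambda>s. \<phi> s x) (at t within {0..<T});
          \<phi>\<^sub>x = vector_derivative (\<phi> t) (at x)
      in u t x * \<phi>\<^sub>t
         - 1/6 * of_real k1 * (u t x) ^ 3 * \<phi>\<^sub>x
         - 1/6 * of_real k1 * (v t x) ^ 3 * \<phi> t x
         - 1/4 * of_real k2 * (u t x)\<^sup>2 * \<phi>\<^sub>x
         - 1/2 * p_conv (\<lambda>y. nonlocal_term k1 k2 (u t y) (v t y)) x * \<phi>\<^sub>x
         + 1/6 * of_real k1 * p_conv (\<lambda>y. (v t y) ^ 3) x * \<phi> t x)"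

text \<open>Weak solutions on $[0,T)$ of
  $m_t = \frac12 k_1 ((u^2-u_x^2)m)_x + \frac12 k_2 (u m_x + 2 m u_x)$, $m = u - u_{xx}$, with
  initial datum \<open>u0\<close>; the identity below is the distributional form of the equation after
  applying $(1-\partial_x^2)^{-1} = p\ast$. For a general \<open>u\<close> in
  $L^\infty_{loc}([0,T);W^{1,3}_{loc})$ the convolutions need not exist, so their existence and
  the integrability of the integrand are required explicitly; otherwise the totalized integrals
  could satisfy the identity by default values.\<close>

definition weak_solution ::
    "real \<Rightarrow> real \<Rightarrow> real \<Rightarrow> (real \<Rightarrow> complex) \<Rightarrow> (real \<Rightarrow> real \<Rightarrow> complex) \<Rightarrow> bool" where
  "weak_solution k1 k2 T u0 u \<longleftrightarrow>
     u0 \<in> W1 (Lp 3) \<and>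
     (\<exists>v. Linfty_loc_W13_loc T u v \<and>
        (AE t in lebesgue. t \<in> {0..<T} \<longrightarrow>
           (AE x in lebesgue. p_conv_exists (\<lambda>y. nonlocal_term k1 k2 (u t y) (v t y)) x \<and>
              p_conv_exists (\<lambda>y. (v t y) ^ 3) x)) \<and>
        (\<forall>\<phi>. test_fun T \<phi> \<longrightarrow>
           set_integrable lebesgue ({0..<T} \<times> UNIV)
             (\<lambda>(t, x). weak_integrand k1 k2 T u v \<phi> t x) \<and>
           (LINT t:{0..<T}|lebesgue. LINT x|lebesgue. weak_integrand k1 k2 T u v \<phi> t x)
             + (LINT x|lebesgue. u0 x * \<phi> 0 x) = 0))"

definition global_weak_solution ::
    "real \<Rightarrow> real \<Rightarrow> (real \<Rightarrow> complex) \<Rightarrow> (real \<Rightarrow> real \<Rightarrow> complex) \<Rightarrow> bool" where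
  "global_weak_solution k1 k2 u0 u \<longleftrightarrow> (\<forall>T>0. weak_solution k1 k2 T u0 u)"

definition peaked_wave :: "complex \<Rightarrow> real \<Rightarrow> real \<Rightarrow> real \<Rightarrow> complex" where
  "peaked_wave C1 c t x = C1 * of_real (exp (- \<bar>x - c * t\<bar>))"

end

theory Submission
  imports Defs
begin

text \<open>
  Write $\xi = x - ct$, $E_a = e^{-a|\xi|}$ and $s = \mathrm{sgn}\,\xi$. The wave is $u = C_1 E_1$ with
  slope $u_x = -C_1 s E_1$, so all the nonlinear terms are combinations of $E_2$, $E_3$ and $s E_3$.
  Convolution with $p$ solves $g - g'' = f$, which gives the closed forms
  $p * E_a = (a E_1 - E_a)/(a^2-1)$ and $p * (s E_a) = (s E_1 - s E_a)/(a^2-1)$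
  (\<open>p_conv_peak\<close>, \<open>p_conv_odd_peak\<close>). With these values the integrand of the weak identity becomes
  $u\phi_t - G\phi_x + H\phi$ with a flux $G$ and a source $H$ that are explicit combinations of
  $E_1$, $E_3$, $s E_1$ and $s E_3$ (\<open>weak_integrand_wave\<close>).

  At a fixed time, integration by parts in $x$ (\<open>peak_by_parts\<close>) turns $-G\phi_x$ into $G_x\phi$. The
  $s E_3$ terms of $G_x + H$ cancel, and what remains is
  $-(\frac13 k_1 C_1^3 + \frac12 k_2 C_1^2)\, s E_1 = c\, C_1 s E_1$, the equality being the condition
  on $C_1$. This is $-c u_x$, so a second integration by parts shows that the $x$-integral equals
  $\int u\,(\phi_t + c\phi_x)\,dx$ (\<open>integral_weak_integrand_wave\<close>).

  In the moving frame $x = y + ct$ the weight $C_1 e^{-|y|}$ does not depend on time, and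
  $\phi_t + c\phi_x$ is the time derivative of $\phi(t, y + ct)$. Exchanging the integrals and integrating
  along each characteristic therefore leaves $-\int u(0,y)\phi(0,y)\,dy$ (\<open>transport_identity\<close>). The
  kink of the wave travels along a characteristic, so $u$ itself is never differentiated in time.
\<close>

section \<open>Integration on the line\<close>

text \<open>Finitely many exceptional points allow for kinks: integration by parts and the convolutions are handled
  by exhibiting a continuous antiderivative that is differentiable away from the crests.\<close>

lemma lborel_integral_FTC_line:
  fixes F h :: "real \<Rightarrow> 'a::euclidean_space"
  assumes F: "continuous_on UNIV F" and S: "finite S"
    and D: "\<And>x. x \<notin> S \<Longrightarrow> (F has_vector_derivative h x) (at x)"
    and h: "integrable lborel h"
    and top: "(F \<longlongrightarrow> L) at_top" and bot: "(F \<longlongrightarrow> M) at_bot"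
  shows "(LINT x|lborel. h x) = L - M"
proof -
  let ?h = "\<lambda>n x. indicator {- real n..real n} x *\<^sub>R h x"
  have lim: "(\<lambda>n. LINT x|lborel. ?h n x) \<longlonglongrightarrow> (LINT x|lborel. h x)"
  proof (rule integral_dominated_convergence)
    show "AE x in lborel. (\<lambda>n. ?h n x) \<longlonglongrightarrow> h x"
    proof (rule AE_I2)
      fix x :: real
      obtain N :: nat where N: "\<bar>x\<bar> \<le> real N" using real_arch_simple by blast
      show "(\<lambda>n. ?h n x) \<longlonglongrightarrow> h x"
        by (rule tendsto_eventually, rule eventually_sequentiallyI[of N])
           (use N in \<open>auto simp: indicator_def\<close>)
    qed
  qed (use h in \<open>auto simp: indicator_def intro!: integrable_norm\<close>)
  have val: "(LINT x|lborel. ?h n x) = F (real n) - F (- real n)" for n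
  proof -
    have "(h has_integral F (real n) - F (- real n)) {- real n..real n}"
      by (rule fundamental_theorem_of_calculus_interior_strong[OF S])
         (use D F in \<open>auto intro: continuous_on_subset\<close>)
    moreover have "set_integrable lborel {- real n..real n} h"
      using h unfolding set_integrable_def by (intro integrable_mult_indicator) auto
    ultimately show ?thesis
      using set_borel_integral_eq_integral(2)[of "{- real n..real n}" h]
      by (simp add: set_lebesgue_integral_def integral_unique)
  qed
  have "(\<lambda>n. F (real n) - F (- real n)) \<longlonglongrightarrow> L - M"
    by (intro tendsto_diff filterlim_compose[OF top] filterlim_compose[OF bot]
          filterlim_real_sequentially filterlim_compose[OF filterlim_uminus_at_bot_at_top])
  with lim show ?thesis unfolding val by (rule LIMSEQ_unique)
qed

text \<open>All integrals below are computed for Borel measurable functions with respect to \<open>lborel\<close>, where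
  substitution and Fubini are available, and then carried over to its completion.\<close>

lemma has_bochner_integral_lebesgue:
  fixes f :: "'a::euclidean_space \<Rightarrow> 'b::{banach, second_countable_topology}"
  assumes "has_bochner_integral lborel f I"
  shows "has_bochner_integral lebesgue f I"
  using assms borel_measurable_has_bochner_integral[OF assms]
  by (simp add: has_bochner_integral_iff integrable_completion integral_completion)

lemma integrable_lebesgue:
  fixes f :: "'a::euclidean_space \<Rightarrow> 'b::{banach, second_countable_topology}"
  assumes "integrable lborel f" shows "integrable lebesgue f"
  using has_bochner_integral_lebesgue[OF has_bochner_integral_integrable[OF assms]]
  by (simp add: has_bochner_integral_iff)

lemma integrable_exp_neg_abs:
  fixes a b :: real assumes "a > 0"
  shows "integrable lborel (\<lambda>x. exp (- a * \<bar>x - b\<bar>))"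
proof -
  let ?g = "\<lambda>x::real. indicator {0..} x *\<^sub>R exp (- a * x)"
  have "(\<lambda>x. exp (- a * x)) absolutely_integrable_on {0..}"
    by (intro nonnegative_absolutely_integrable_1 integrable_on_exp_minus_to_infinity assms) auto
  hence "integrable lebesgue ?g" by (simp add: set_integrable_def)
  hence g: "integrable lborel ?g"
    by (subst (asm) integrable_completion) (auto simp del: real_scaleR_def)
  have "integrable lborel (\<lambda>x. ?g (- b + 1 * x))" "integrable lborel (\<lambda>x. ?g (b + - 1 * x))"
    using lborel_integrable_real_affine[OF g, of "1" "-b"]
      lborel_integrable_real_affine[OF g, of "-1" "b"] by (simp_all del: real_scaleR_def)
  hence "integrable lborel (\<lambda>x. ?g (- b + 1 * x) + ?g (b + - 1 * x))"
    by (rule Bochner_Integration.integrable_add)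
  thus ?thesis
    by (rule Bochner_Integration.integrable_bound) (auto simp: indicator_def abs_if)
qed

section \<open>Symmetric and antisymmetric peaks\<close>

definition peak :: "real \<Rightarrow> real \<Rightarrow> real \<Rightarrow> complex" where
  "peak a b x = of_real (exp (- a * \<bar>x - b\<bar>))"

text \<open>The value at the crest is \<open>1\<close> and not \<open>0\<close>, so that the square of an antisymmetric peak is a
  symmetric peak at every point, the crest included.\<close>

definition odd_peak :: "real \<Rightarrow> real \<Rightarrow> real \<Rightarrow> complex" where
  "odd_peak a b x = (if b \<le> x then peak a b x else - peak a b x)"

lemma norm_peak: "norm (peak a b x) = exp (- a * \<bar>x - b\<bar>)"
  by (simp add: peak_def)

lemma norm_odd_peak: "norm (odd_peak a b x) = exp (- a * \<bar>x - b\<bar>)"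
  by (simp add: odd_peak_def norm_peak)

lemma peak_measurable [measurable]: "peak a b \<in> borel_measurable borel"
  unfolding peak_def by measurable

lemma odd_peak_measurable [measurable]: "odd_peak a b \<in> borel_measurable borel"
  unfolding odd_peak_def by measurable

lemma peak_continuous: "continuous_on UNIV (peak a b)"
  unfolding peak_def by (intro continuous_intros)

lemma peak_power: "peak a b x ^ n = peak (real n * a) b x"
  by (simp add: peak_def exp_of_nat_mult[symmetric] algebra_simps flip: of_real_power)

lemma odd_peak_square: "odd_peak a b x ^ 2 = peak (2 * a) b x"
  using peak_power[of a b x 2] by (simp add: odd_peak_def)

lemma odd_peak_cube: "odd_peak a b x ^ 3 = odd_peak (3 * a) b x"
  using peak_power[of a b x 3] by (simp add: odd_peak_def)

lemma peak_deriv: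
  assumes "x \<noteq> b"
  shows "(peak a b has_vector_derivative - of_real a * odd_peak a b x) (at x)"
proof (cases "x > b")
  case True
  have "((\<lambda>x. of_real (exp (- a * (x - b))) :: complex) has_vector_derivative
          of_real (- a * exp (- a * (x - b)))) (at x)"
    by (intro has_vector_derivative_of_real) 
       (auto intro!: derivative_eq_intros simp flip: has_real_derivative_iff_has_vector_derivative)
  hence "(peak a b has_vector_derivative of_real (- a * exp (- a * (x - b)))) (at x)"
    by (rule has_vector_derivative_transform_within_open[of _ _ _ "{b<..}"])
       (use True in \<open>auto simp: peak_def\<close>)
  thus ?thesis using True by (simp add: odd_peak_def peak_def)
next
  case False
  have "((\<lambda>x. of_real (exp (a * (x - b))) :: complex) has_vector_derivative
          of_real (a * exp (a * (x - b)))) (at x)"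
    by (intro has_vector_derivative_of_real)
       (auto intro!: derivative_eq_intros simp flip: has_real_derivative_iff_has_vector_derivative)
  hence "(peak a b has_vector_derivative of_real (a * exp (a * (x - b)))) (at x)"
    by (rule has_vector_derivative_transform_within_open[of _ _ _ "{..<b}"])
       (use False assms in \<open>auto simp: peak_def algebra_simps\<close>)
  thus ?thesis using False assms by (simp add: odd_peak_def peak_def algebra_simps)
qed

lemma odd_peak_deriv:
  assumes "x \<noteq> b"
  shows "(odd_peak a b has_vector_derivative - of_real a * peak a b x) (at x)"
proof (cases "x > b")
  case True
  have "(odd_peak a b has_vector_derivative - of_real a * odd_peak a b x) (at x)"
    by (rule has_vector_derivative_transform_within_open[OF peak_deriv[OF assms], of "{b<..}"])
       (use True in \<open>auto simp: peak_def odd_peak_def\<close>)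
  thus ?thesis using True by (simp add: odd_peak_def peak_def)
next
  case False
  have "(odd_peak a b has_vector_derivative - (- of_real a * odd_peak a b x)) (at x)"
    by (rule has_vector_derivative_transform_within_open
          [OF has_vector_derivative_minus[OF peak_deriv[OF assms]], of "{..<b}"])
       (use False assms in \<open>auto simp: peak_def odd_peak_def\<close>)
  thus ?thesis using False assms by (simp add: odd_peak_def peak_def)
qed

text \<open>Both peaks jump from \<open>-1\<close> to \<open>1\<close> at the crest, and in the difference the jumps cancel.\<close>
lemma odd_peak_diff_continuous: "continuous_on UNIV (\<lambda>x. odd_peak a b x - odd_peak a' b x)"
proof -
  let ?d = "\<lambda>x. peak a b x - peak a' b x"
  have d: "continuous_on T ?d" for T
    unfolding peak_def by (intro continuous_intros)
  have "continuous_on ({b..} \<union> {..b}) (\<lambda>x. if b \<le> x then ?d x else - ?d x)"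
    by (rule continuous_on_cases) (use d continuous_on_minus[OF d] in \<open>auto simp: peak_def\<close>)
  moreover have "(\<lambda>x. if b \<le> x then ?d x else - ?d x) = (\<lambda>x. odd_peak a b x - odd_peak a' b x)"
    by (auto simp: peak_def odd_peak_def)
  moreover have "{b..} \<union> {..b} = UNIV" by auto
  ultimately show ?thesis by (simp only:)
qed

text \<open>Coefficients are only bounded and measurable, because \<open>odd_peak\<close> jumps. The second factor is cut off
  by an indicator so that continuity is needed on the support only: a test function on
  $[0,T)\times\mathbb{R}$ has no prescribed behaviour at other times.\<close>

lemma integrable_mult_compact_support:
  fixes w \<psi> :: "'a::euclidean_space \<Rightarrow> complex"
  assumes w [measurable]: "w \<in> borel_measurable borel" and M: "\<And>x. norm (w x) \<le> M"
    and K: "compact K" and \<psi>: "continuous_on K \<psi>"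
  shows "integrable lborel (\<lambda>x. w x * (indicator K x *\<^sub>R \<psi> x))"
proof (rule Bochner_Integration.integrable_bound)
  have [measurable]: "K \<in> sets borel" using K by (simp add: borel_compact)
  have I: "integrable lborel (\<lambda>x. indicator K x *\<^sub>R \<psi> x)"
    using borel_integrable_compact[OF K \<psi>] .
  show "integrable lborel (\<lambda>x. M * norm (indicator K x *\<^sub>R \<psi> x))"
    by (intro integrable_mult_right integrable_norm I)
  show "(\<lambda>x. w x * (indicator K x *\<^sub>R \<psi> x)) \<in> borel_measurable lborel"
    using borel_measurable_integrable[OF I] by measurable
  show "AE x in lborel. norm (w x * (indicator K x *\<^sub>R \<psi> x))
      \<le> norm (M * norm (indicator K x *\<^sub>R \<psi> x))"
  proof (rule AE_I2)
    fix x
    have "norm (w x * (indicator K x *\<^sub>R \<psi> x)) \<le> M * norm (indicator K x *\<^sub>R \<psi> x)"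
      unfolding norm_mult by (intro mult_right_mono M) simp
    thus "norm (w x * (indicator K x *\<^sub>R \<psi> x)) \<le> norm (M * norm (indicator K x *\<^sub>R \<psi> x))"
      by (rule order_trans) simp
  qed
qed

lemma peak_bounded:
  assumes "a \<ge> 0" shows "norm (peak a b x) \<le> 1" "norm (odd_peak a b x) \<le> 1"
  using assms by (simp_all add: norm_peak norm_odd_peak)

lemma integrable_peak_mult:
  assumes "a > 0" and [measurable]: "f \<in> borel_measurable borel" and M: "\<And>x. norm (f x) \<le> M"
  shows "integrable lborel (\<lambda>x. peak a b x * f x)"
proof (rule Bochner_Integration.integrable_bound)
  show "integrable lborel (\<lambda>x. exp (- a * \<bar>x - b\<bar>) * M)"
    by (intro integrable_mult_left integrable_exp_neg_abs assms)
  show "AE x in lborel. norm (peak a b x * f x) \<le> norm (exp (- a * \<bar>x - b\<bar>) * M)"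
  proof (rule AE_I2)
    fix x
    have "norm (peak a b x * f x) \<le> exp (- a * \<bar>x - b\<bar>) * M"
      unfolding norm_mult norm_peak by (intro mult_left_mono M) simp
    thus "norm (peak a b x * f x) \<le> norm (exp (- a * \<bar>x - b\<bar>) * M)"
      by (rule order_trans) simp
  qed
qed measurable

section \<open>Integration by parts against a peak\<close>

lemma vanishing_derivative:
  fixes \<psi> \<psi>' :: "real \<Rightarrow> complex"
  assumes "\<And>x. (\<psi> has_vector_derivative \<psi>' x) (at x)"
    and "\<And>x. \<bar>x\<bar> > R \<Longrightarrow> \<psi> x = 0" and x: "\<bar>x\<bar> > R"
  shows "\<psi>' x = 0"
proof -
  have "open {x::real. \<bar>x\<bar> > R}" by (intro open_Collect_less continuous_intros)
  hence "((\<lambda>_. 0) has_vector_derivative \<psi>' x) (at x)"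
    by (rule has_vector_derivative_transform_within_open[OF assms(1)]) (use assms in auto)
  thus ?thesis
    using has_vector_derivative_const vector_derivative_unique_at by blast
qed

lemma peak_by_parts:
  fixes \<psi> \<psi>' :: "real \<Rightarrow> complex"
  assumes a: "a > 0" and \<psi>: "\<And>x. (\<psi> has_vector_derivative \<psi>' x) (at x)"
    and \<psi>': "continuous_on UNIV \<psi>'" and R: "\<And>x. \<bar>x\<bar> > R \<Longrightarrow> \<psi> x = 0"
  shows "integrable lborel (\<lambda>x. peak a b x * \<psi>' x)"
    and "integrable lborel (\<lambda>x. odd_peak a b x * \<psi> x)"
    and "(LINT x|lborel. peak a b x * \<psi>' x) = of_real a * (LINT x|lborel. odd_peak a b x * \<psi> x)"
proof -
  have cont: "continuous_on UNIV \<psi>"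
    using \<psi> has_vector_derivative_continuous continuous_at_imp_continuous_on by blast
  have z: "\<psi>' x = 0" if "\<bar>x\<bar> > R" for x
    using vanishing_derivative[OF \<psi> R that] .
  have eq: "\<psi> = (\<lambda>x. indicator {-R..R} x *\<^sub>R \<psi> x)" "\<psi>' = (\<lambda>x. indicator {-R..R} x *\<^sub>R \<psi>' x)"
    using R z by (auto simp: indicator_def fun_eq_iff)
  show 1: "integrable lborel (\<lambda>x. peak a b x * \<psi>' x)"
    by (subst eq(2), rule integrable_mult_compact_support[where M = 1])
       (use peak_bounded(1) a \<psi>' in \<open>auto intro: continuous_on_subset\<close>)
  show 2: "integrable lborel (\<lambda>x. odd_peak a b x * \<psi> x)"
    by (subst eq(1), rule integrable_mult_compact_support[where M = 1])
       (use peak_bounded(2) a cont in \<open>auto intro: continuous_on_subset\<close>)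
  have "(LINT x|lborel. peak a b x * \<psi>' x - of_real a * (odd_peak a b x * \<psi> x)) = 0 - 0"
  proof (rule lborel_integral_FTC_line[where F = "\<lambda>x. peak a b x * \<psi> x" and S = "{b}"])
    show "continuous_on UNIV (\<lambda>x. peak a b x * \<psi> x)"
      by (intro continuous_intros peak_continuous cont)
    show "((\<lambda>x. peak a b x * \<psi> x) has_vector_derivative
        peak a b x * \<psi>' x - of_real a * (odd_peak a b x * \<psi> x)) (at x)" if "x \<notin> {b}" for x
      using has_vector_derivative_mult[OF peak_deriv \<psi>, of x b a] that by (simp add: algebra_simps)
    show "integrable lborel (\<lambda>x. peak a b x * \<psi>' x - of_real a * (odd_peak a b x * \<psi> x))"
      using 1 2 by simp
    show "((\<lambda>x. peak a b x * \<psi> x) \<longlongrightarrow> 0) at_top"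
      by (rule tendsto_eventually, rule eventually_mono[OF eventually_gt_at_top[of R]]) (use R in auto)
    show "((\<lambda>x. peak a b x * \<psi> x) \<longlongrightarrow> 0) at_bot"
      by (rule tendsto_eventually, rule eventually_mono[OF eventually_gt_at_bot[of "-R"]]) (use R in auto)
  qed simp
  thus "(LINT x|lborel. peak a b x * \<psi>' x) = of_real a * (LINT x|lborel. odd_peak a b x * \<psi> x)"
    using 1 2 by simp
qed

section \<open>Convolution with the kernel\<close>

lemma peak_tendsto_0: "(peak 1 b \<longlongrightarrow> 0) at_top" "(peak 1 b \<longlongrightarrow> 0) at_bot"
proof -
  have "((\<lambda>x. exp (- \<bar>x - b\<bar>)) \<longlongrightarrow> 0) at_top" "((\<lambda>x. exp (- \<bar>x - b\<bar>)) \<longlongrightarrow> 0) at_bot"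
    by real_asymp+
  thus "(peak 1 b \<longlongrightarrow> 0) at_top" "(peak 1 b \<longlongrightarrow> 0) at_bot"
    unfolding peak_def by (simp_all add: tendsto_of_real_iff[of _ 0, simplified])
qed

text \<open>This says that \<open>p\<close> is the fundamental solution of $1 - \partial_x^2$. With $q(y) = e^{-|x-y|}$, so that
  $q'' = q$ for $y \neq x$, one has $(q'g - qg')' = qf$ away from \<open>x\<close> and \<open>b\<close>, and \<open>q'\<close> jumps by
  \<open>-2\<close> at $y = x$. Since \<open>q\<close> and \<open>q'\<close> decay while \<open>g\<close> and \<open>g'\<close> stay bounded, $\int qf$ is the
  contribution $2g(x)$ of that jump.\<close>

lemma p_conv_resolvent:
  fixes f g g' :: "real \<Rightarrow> complex"
  assumes g: "continuous_on UNIV g" "\<And>y. norm (g y) \<le> M"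
    and g': "continuous_on UNIV g'" "\<And>y. norm (g' y) \<le> M"
    and f [measurable]: "f \<in> borel_measurable borel" and fM: "\<And>y. norm (f y) \<le> M"
    and dg: "\<And>y. y \<noteq> b \<Longrightarrow> (g has_vector_derivative g' y) (at y)"
    and dg': "\<And>y. y \<noteq> b \<Longrightarrow> (g' has_vector_derivative g y - f y) (at y)"
  shows "has_bochner_integral lebesgue (\<lambda>y. kernel_p (x - y) *\<^sub>R f y) (g x)"
proof -
  let ?q = "peak 1 x"
  (* The function q' g - q g', shifted by 2 g(x) to the right of x to make it continuous there. *)
  let ?F = "\<lambda>y. if y \<le> x then ?q y * (g y - g' y) else 2 * g x - ?q y * (g y + g' y)"
  have I: "integrable lborel (\<lambda>y. ?q y * f y)"
    by (rule integrable_peak_mult) (use fM in auto)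
  have "(LINT y|lborel. ?q y * f y) = 2 * g x - 0"
  proof (rule lborel_integral_FTC_line[where F = ?F and S = "{x, b}"])
    have "continuous_on ({..x} \<union> {x..}) ?F"
      by (rule continuous_on_cases)
         (auto intro!: continuous_intros continuous_on_subset[OF g(1)] continuous_on_subset[OF g'(1)]
            continuous_on_subset[OF peak_continuous] simp: peak_def)
    moreover have "{..x} \<union> {x..} = UNIV" by auto
    ultimately show "continuous_on UNIV ?F" by simp
  next
    fix y assume y: "y \<notin> {x, b}"
    note dq = peak_deriv[of y x 1]
    show "(?F has_vector_derivative ?q y * f y) (at y)"
    proof (cases "y < x")
      case True
      have "((\<lambda>y. ?q y * (g y - g' y)) has_vector_derivative ?q y * f y) (at y)"
        using has_vector_derivative_mult[OF dq has_vector_derivative_diff[OF dg dg']] y True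
        by (simp add: odd_peak_def algebra_simps)
      thus ?thesis
        by (rule has_vector_derivative_transform_within_open[of _ _ _ "{..<x}"]) (use True in auto)
    next
      case False
      have "((\<lambda>y. 2 * g x - ?q y * (g y + g' y)) has_vector_derivative 0 - (- (?q y * f y))) (at y)"
        using has_vector_derivative_mult[OF dq has_vector_derivative_add[OF dg dg']] y False
        by (intro has_vector_derivative_diff has_vector_derivative_const)
           (simp add: odd_peak_def algebra_simps)
      hence "((\<lambda>y. 2 * g x - ?q y * (g y + g' y)) has_vector_derivative ?q y * f y) (at y)"
        by simp
      thus ?thesis
        by (rule has_vector_derivative_transform_within_open[of _ _ _ "{x<..}"]) (use False y in auto)
    qed
  next
    have bnd: "norm (g y + g' y) \<le> 2 * M" "norm (g y - g' y) \<le> 2 * M" for y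
      using norm_triangle_ineq[of "g y" "g' y"] norm_triangle_ineq4[of "g y" "g' y"] g(2)[of y] g'(2)[of y]
      by linarith+
    have "((\<lambda>y. 2 * g x - ?q y * (g y + g' y)) \<longlongrightarrow> 2 * g x - 0) at_top"
      by (intro tendsto_diff tendsto_const lim_null_mult_right_bounded[where B = "2 * M"])
         (use peak_tendsto_0 bnd in auto)
    thus "(?F \<longlongrightarrow> 2 * g x) at_top"
      by (elim filterlim_mono_eventually)
         (auto intro!: eventually_mono[OF eventually_gt_at_top[of x]])
    have "((\<lambda>y. ?q y * (g y - g' y)) \<longlongrightarrow> 0) at_bot"
      by (intro lim_null_mult_right_bounded[where B = "2 * M"]) (use peak_tendsto_0 bnd in auto)
    thus "(?F \<longlongrightarrow> 0) at_bot"
      by (elim filterlim_mono_eventually)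
         (auto intro!: eventually_mono[OF eventually_gt_at_bot[of x]])
  qed (use I in auto)
  with I have "has_bochner_integral lborel (\<lambda>y. ?q y * f y) (2 * g x)"
    by (simp add: has_bochner_integral_iff)
  hence "has_bochner_integral lborel (\<lambda>y. 1/2 * (?q y * f y)) (1/2 * (2 * g x))"
    by (intro has_bochner_integral_mult_right)
  moreover have "(\<lambda>y. 1/2 * (?q y * f y)) = (\<lambda>y. kernel_p (x - y) *\<^sub>R f y)"
    by (simp add: fun_eq_iff peak_def kernel_p_def scaleR_conv_of_real abs_minus_commute)
  ultimately have "has_bochner_integral lborel (\<lambda>y. kernel_p (x - y) *\<^sub>R f y) (g x)"
    by simp
  thus ?thesis by (rule has_bochner_integral_lebesgue)
qed

text \<open>Away from the crest $E_a'' = a^2 E_a$, so $(1-\partial_x^2)E_a = (1-a^2)E_a$ up to a singular part at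
  the crest; the multiple of $E_1$, which \<open>1 - \<partial>\<^sub>x\<^sup>2\<close> annihilates there, is chosen to make the
  combination continuously differentiable, which removes the singular part. The antisymmetric case is
  analogous, the combination now being chosen to be continuous.\<close>

lemma
  assumes a: "a > 0" "a \<noteq> 1"
  defines "\<kappa> \<equiv> 1 / (of_real a ^ 2 - 1)"
  shows p_conv_peak: "has_bochner_integral lebesgue (\<lambda>y. kernel_p (x - y) *\<^sub>R peak a b y)
      (\<kappa> * (of_real a * peak 1 b x - peak a b x))" (is ?A)
    and p_conv_odd_peak: "has_bochner_integral lebesgue (\<lambda>y. kernel_p (x - y) *\<^sub>R odd_peak a b y)
      (\<kappa> * (odd_peak 1 b x - odd_peak a b x))" (is ?B)
proof -
  have "complex_of_real (a ^ 2) \<noteq> of_real 1"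
    unfolding of_real_eq_iff using a by (simp add: power2_eq_1_iff)
  hence k: "\<kappa> * of_real a ^ 2 = \<kappa> + 1" by (simp add: \<kappa>_def field_simps)
  (* One crude bound that serves the right-hand side, the solution and its derivative at once. *)
  let ?M = "1 + norm \<kappa> * ((1 + a) * (1 + a))"
  note [simp] = norm_mult
  have b1: "norm (of_real s * peak 1 b y + of_real r * peak a b y) \<le> \<bar>s\<bar> + \<bar>r\<bar>"
    "norm (of_real s * odd_peak 1 b y + of_real r * odd_peak a b y) \<le> \<bar>s\<bar> + \<bar>r\<bar>" for s r y
    using norm_triangle_mono[of "of_real s * peak 1 b y" "\<bar>s\<bar>" "of_real r * peak a b y" "\<bar>r\<bar>"]
      norm_triangle_mono[of "of_real s * odd_peak 1 b y" "\<bar>s\<bar>" "of_real r * odd_peak a b y" "\<bar>r\<bar>"]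
      peak_bounded[of 1 b y] peak_bounded[of a b y] a by (simp_all add: mult_left_le)
  have b: "norm (\<kappa> * z) \<le> ?M" if "norm z \<le> s" "s \<le> (1 + a) * (1 + a)" for z s
  proof -
    have "norm \<kappa> * norm z \<le> norm \<kappa> * ((1 + a) * (1 + a))"
      using that by (intro mult_left_mono) auto
    thus ?thesis by simp
  qed
  have M1: "1 \<le> ?M" using a by simp
  have sq: "1 + a \<le> (1 + a) * (1 + a)" "a + a \<le> (1 + a) * (1 + a)"
    using a by (auto simp: algebra_simps)
  show ?A
  proof (rule p_conv_resolvent[where b = b and M = ?M and
        g' = "\<lambda>y. \<kappa> * (of_real a * (odd_peak a b y - odd_peak 1 b y))"])
    show "continuous_on UNIV (\<lambda>y. \<kappa> * (of_real a * peak 1 b y - peak a b y))"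
      by (intro continuous_intros peak_continuous)
    show "continuous_on UNIV (\<lambda>y. \<kappa> * (of_real a * (odd_peak a b y - odd_peak 1 b y)))"
      by (intro continuous_on_mult continuous_on_const odd_peak_diff_continuous)
    show "norm (\<kappa> * (of_real a * peak 1 b y - peak a b y)) \<le> ?M" for y
      using b[OF b1(1)[of a y "-1"]] a sq by simp
    show "norm (\<kappa> * (of_real a * (odd_peak a b y - odd_peak 1 b y))) \<le> ?M" for y
      using b[OF b1(2)[of "-a" y "a"]] a sq by (simp add: algebra_simps)
    show "norm (peak a b y) \<le> ?M" for y
      using peak_bounded[of a b y] a M1 by linarith
    show "((\<lambda>y. \<kappa> * (of_real a * peak 1 b y - peak a b y)) has_vector_derivative
        \<kappa> * (of_real a * (odd_peak a b y - odd_peak 1 b y))) (at y)" if "y \<noteq> b" for y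
      using that by (auto intro!: derivative_eq_intros peak_deriv simp: algebra_simps)
    have "((\<lambda>y. \<kappa> * (of_real a * (odd_peak a b y - odd_peak 1 b y))) has_vector_derivative
        \<kappa> * of_real a * peak 1 b y - (\<kappa> * of_real a ^ 2) * peak a b y) (at y)" if "y \<noteq> b" for y
      using that by (auto intro!: derivative_eq_intros odd_peak_deriv simp: algebra_simps power2_eq_square)
    thus "((\<lambda>y. \<kappa> * (of_real a * (odd_peak a b y - odd_peak 1 b y))) has_vector_derivative
        \<kappa> * (of_real a * peak 1 b y - peak a b y) - peak a b y) (at y)" if "y \<noteq> b" for y
      using that unfolding k by (simp add: algebra_simps)
  qed measurable
  show ?B
  proof (rule p_conv_resolvent[where b = b and M = ?M and
        g' = "\<lambda>y. \<kappa> * (of_real a * peak a b y - peak 1 b y)"])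
    show "continuous_on UNIV (\<lambda>y. \<kappa> * (of_real a * peak a b y - peak 1 b y))"
      by (intro continuous_intros peak_continuous)
    show "continuous_on UNIV (\<lambda>y. \<kappa> * (odd_peak 1 b y - odd_peak a b y))"
      by (intro continuous_on_mult continuous_on_const odd_peak_diff_continuous)
    show "norm (\<kappa> * (of_real a * peak a b y - peak 1 b y)) \<le> ?M" for y
      using b[OF b1(1)[of "-1" y a]] a sq by simp
    show "norm (\<kappa> * (odd_peak 1 b y - odd_peak a b y)) \<le> ?M" for y
    proof -
      have "norm (odd_peak 1 b y - odd_peak a b y) = \<bar>exp (- \<bar>y - b\<bar>) - exp (- a * \<bar>y - b\<bar>)\<bar>"
        by (simp add: odd_peak_def peak_def flip: of_real_diff)
           (simp add: abs_minus_commute flip: of_real_diff)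
      also have "\<dots> \<le> 1"
      proof -
        have "exp (- \<bar>y - b\<bar>) \<le> 1" "exp (- a * \<bar>y - b\<bar>) \<le> 1" using a by simp_all
        moreover have "exp (- \<bar>y - b\<bar>) > 0" "exp (- a * \<bar>y - b\<bar>) > 0" by simp_all
        ultimately show ?thesis by linarith
      qed
      finally show ?thesis by (rule b) (use a in \<open>simp add: algebra_simps\<close>)
    qed
    show "norm (odd_peak a b y) \<le> ?M" for y
      using peak_bounded[of a b y] a M1 by linarith
    show "((\<lambda>y. \<kappa> * (odd_peak 1 b y - odd_peak a b y)) has_vector_derivative
        \<kappa> * (of_real a * peak a b y - peak 1 b y)) (at y)" if "y \<noteq> b" for y
      using that by (auto intro!: derivative_eq_intros odd_peak_deriv simp: algebra_simps)
    have "((\<lambda>y. \<kappa> * (of_real a * peak a b y - peak 1 b y)) has_vector_derivative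
        \<kappa> * odd_peak 1 b y - (\<kappa> * of_real a ^ 2) * odd_peak a b y) (at y)" if "y \<noteq> b" for y
      using that by (auto intro!: derivative_eq_intros peak_deriv simp: algebra_simps power2_eq_square)
    thus "((\<lambda>y. \<kappa> * (of_real a * peak a b y - peak 1 b y)) has_vector_derivative
        \<kappa> * (odd_peak 1 b y - odd_peak a b y) - odd_peak a b y) (at y)" if "y \<noteq> b" for y
      using that unfolding k by (simp add: algebra_simps)
  qed measurable
qed

section \<open>Test functions on the half-open time interval\<close>

lemma at_within_time_interval:
  fixes t T :: real
  assumes "t \<in> {0..<T}" shows "at t within {0..<T} \<noteq> bot"
proof -
  have "{0..<T} \<noteq> {x}" for x
  proof
    assume eq: "{0..<T} = {x}"
    have "t \<in> {0..<T}" "(t + T) / 2 \<in> {0..<T}" using assms by auto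
    with eq assms show False by auto
  qed
  hence "t islimpt {0..<T}"
    by (rule connected_imp_perfect[OF convex_connected[OF convex_real_interval(7)] assms])
  thus ?thesis by (simp add: trivial_limit_within)
qed

text \<open>Only the first derivatives of a test function enter the weak identity. The support lies in a box
  whose time range ends at \<open>S\<close>, strictly before \<open>T\<close>; that the functions also vanish at the time
  \<open>S\<close> itself makes the boundary term at the end of a characteristic disappear.\<close>

locale box_supported =
  fixes T S R :: real and \<phi> \<phi>t \<phi>x :: "real \<Rightarrow> real \<Rightarrow> complex"
  assumes S: "0 \<le> S" "S < T"
    and continuous: "continuous_on ({0..<T} \<times> UNIV) (\<lambda>(t, x). \<phi> t x)"
      "continuous_on ({0..<T} \<times> UNIV) (\<lambda>(t, x). \<phi>t t x)"
      "continuous_on ({0..<T} \<times> UNIV) (\<lambda>(t, x). \<phi>x t x)"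
    and deriv_t: "t \<in> {0..<T} \<Longrightarrow> ((\<lambda>s. \<phi> s x) has_vector_derivative \<phi>t t x) (at t within {0..<T})"
    and deriv_x: "t \<in> {0..<T} \<Longrightarrow> (\<phi> t has_vector_derivative \<phi>x t x) (at x)"
    and vanish: "t \<in> {0..<T} \<Longrightarrow> S \<le> t \<or> R < \<bar>x\<bar> \<Longrightarrow> \<phi> t x = 0 \<and> \<phi>t t x = 0 \<and> \<phi>x t x = 0"

lemma test_fun_imp_box_supported:
  assumes \<phi>: "test_fun T \<phi>" and T: "T > 0"
  shows "\<exists>S R \<phi>t \<phi>x. box_supported T S R \<phi> \<phi>t \<phi>x"
proof -
  from \<phi> obtain D where D0: "D 0 0 = \<phi>"
    and *: "\<forall>i j. continuous_on ({0..<T} \<times> UNIV) (\<lambda>(t, x). D i j t x) \<and>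
           (\<forall>t\<in>{0..<T}. \<forall>x.
              ((\<lambda>s. D i j s x) has_vector_derivative D (Suc i) j t x) (at t within {0..<T}) \<and>
              (D i j t has_vector_derivative D i (Suc j) t x) (at x))"
    unfolding test_fun_def by (elim conjE exE) (rule that)
  have D: "continuous_on ({0..<T} \<times> UNIV) (\<lambda>(t, x). D i j t x)" for i j
    using * by blast
  have Dt: "((\<lambda>s. D i j s x) has_vector_derivative D (Suc i) j t x) (at t within {0..<T})"
    if "t \<in> {0..<T}" for i j t x
    using * that by blast
  have Dx: "(D i j t has_vector_derivative D i (Suc j) t x) (at x)"
    if "t \<in> {0..<T}" for i j t x
    using * that by blast
  from \<phi> obtain K where K: "compact K" "K \<subseteq> {0..<T} \<times> UNIV"
    and z: "\<And>t x. t \<in> {0..<T} \<Longrightarrow> (t, x) \<notin> K \<Longrightarrow> \<phi> t x = 0"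
    unfolding test_fun_def by (elim conjE exE) (rule that, blast+)
  have "\<exists>S0\<in>{0..<T}. \<forall>(t, x)\<in>K. t \<le> S0"
  proof (cases "K = {}")
    case False
    have "compact (fst ` K)" using K(1) by (intro compact_continuous_image continuous_intros)
    then obtain s where s: "s \<in> fst ` K" "\<forall>t\<in>fst ` K. t \<le> s"
      using compact_attains_sup[of "fst ` K"] False by auto
    have "t \<le> s" if "(t, x) \<in> K" for t x
      using s(2) that by force
    moreover have "s \<in> {0..<T}" using s(1) K(2) by auto
    ultimately show ?thesis by blast
  qed (use T in auto)
  then obtain S0 where S0: "S0 \<in> {0..<T}" "\<And>t x. (t, x) \<in> K \<Longrightarrow> t \<le> S0" by blast
  obtain R where R: "\<And>z. z \<in> K \<Longrightarrow> norm z \<le> R"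
    using compact_imp_bounded[OF K(1)] bounded_iff by blast
  have out: "\<phi> t x = 0" if "t \<in> {0..<T}" "S0 < t \<or> R < \<bar>x\<bar>" for t x
  proof (rule z[OF that(1)])
    show "(t, x) \<notin> K"
      using S0(2)[of t x] R[of "(t, x)"] that(2) norm_snd_le[of x t] by auto
  qed
  have out_t: "D 1 0 t x = 0" if t: "t \<in> {0..<T}" and "S0 < t \<or> R < \<bar>x\<bar>" for t x
  proof -
    have "((\<lambda>s. 0) has_vector_derivative D 1 0 t x) (at t within {0..<T})"
    proof (cases "R < \<bar>x\<bar>")
      case True
      show ?thesis
        using Dt[OF t, of 0 0 x] unfolding D0 One_nat_def
        by (rule has_vector_derivative_transform_within[where d = 1, simplified])
           (use True t out in auto)
    next
      case False
      show ?thesis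
        using Dt[OF t, of 0 0 x] unfolding D0 One_nat_def
        by (rule has_vector_derivative_transform_within[where d = "t - S0", simplified])
           (use False t that out in \<open>auto simp: dist_real_def\<close>)
    qed
    thus ?thesis
      using vector_derivative_unique_within[OF at_within_time_interval[OF t]]
        has_vector_derivative_const by blast
  qed
  have out_x: "D 0 1 t x = 0" if t: "t \<in> {0..<T}" and "S0 < t \<or> R < \<bar>x\<bar>" for t x
  proof -
    have open_out: "open {x. S0 < t \<or> R < \<bar>x\<bar>}"
      by (intro open_Collect_disj open_Collect_less continuous_intros)
    have "(\<phi> t has_vector_derivative D 0 1 t x) (at x)"
      using Dx[OF t, of 0 0 x] by (simp add: D0)
    hence "((\<lambda>_. 0) has_vector_derivative D 0 1 t x) (at x)"
      by (rule has_vector_derivative_transform_within_open[OF _ open_out]) (use that out in auto)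
    thus ?thesis
      using has_vector_derivative_const vector_derivative_unique_at by blast
  qed
  (* Passing from S0 to the midpoint gives vanishing at the end time of the box, too. *)
  have "box_supported T ((S0 + T) / 2) R \<phi> (D 1 0) (D 0 1)"
  proof
    show "((\<lambda>s. \<phi> s x) has_vector_derivative D 1 0 t x) (at t within {0..<T})"
      if "t \<in> {0..<T}" for t x
      using Dt[OF that, of 0 0 x] by (simp add: D0)
    show "(\<phi> t has_vector_derivative D 0 1 t x) (at x)" if "t \<in> {0..<T}" for t x
      using Dx[OF that, of 0 0 x] by (simp add: D0)
    show "\<phi> t x = 0 \<and> D 1 0 t x = 0 \<and> D 0 1 t x = 0"
      if "t \<in> {0..<T}" "(S0 + T) / 2 \<le> t \<or> R < \<bar>x\<bar>" for t x
      using that(2) S0(1) by (intro conjI out out_t out_x that(1)) auto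
    show "continuous_on ({0..<T} \<times> UNIV) (\<lambda>(t, x). \<phi> t x)"
      using D[of 0 0] by (simp add: D0)
  qed (use S0(1) in \<open>simp_all add: D\<close>)
  thus ?thesis by blast
qed

context box_supported
begin

lemma vector_derivative_time:
  "t \<in> {0..<T} \<Longrightarrow> vector_derivative (\<lambda>s. \<phi> s x) (at t within {0..<T}) = \<phi>t t x"
  by (rule vector_derivative_within[OF at_within_time_interval deriv_t])

lemma vector_derivative_space: "t \<in> {0..<T} \<Longrightarrow> vector_derivative (\<phi> t) (at x) = \<phi>x t x"
  by (rule vector_derivative_at[OF deriv_x])

lemma continuous_slice:
  assumes "continuous_on ({0..<T} \<times> UNIV) (\<lambda>(t, x). \<psi> t x)" "t \<in> {0..<T}"
  shows "continuous_on UNIV (\<psi> t :: real \<Rightarrow> complex)"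
proof -
  have "continuous_on UNIV (\<lambda>x. (\<lambda>(t, x). \<psi> t x) (t, x))"
    by (rule continuous_on_compose2[OF assms(1)]) (use assms(2) in \<open>auto intro!: continuous_intros\<close>)
  thus ?thesis by simp
qed

text \<open>The chain rule. Joint differentiability follows from the partial derivatives because the one in \<open>x\<close>
  is jointly continuous; at $t = 0$ the derivative is one-sided.\<close>

lemma deriv_characteristic:
  assumes t: "t \<in> {0..<T}"
  shows "((\<lambda>s. \<phi> s (y + c * s)) has_vector_derivative \<phi>t t (y + c * t) + of_real c * \<phi>x t (y + c * t))
           (at t within {0..<T})"
proof -
  let ?x = "y + c * t"
  have "((\<lambda>(s, x). \<phi> s x) has_derivative
      (\<lambda>(hs, hx). hs *\<^sub>R \<phi>t t ?x + blinfun_apply (blinfun_scaleR_left (\<phi>x t ?x)) hx))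
      (at (t, ?x) within {0..<T} \<times> UNIV)"
  proof (rule has_derivative_partialsI)
    show "((\<lambda>s. \<phi> s ?x) has_derivative (\<lambda>hs. hs *\<^sub>R \<phi>t t ?x)) (at t within {0..<T})"
      using deriv_t[OF t] by (simp add: has_vector_derivative_def)
    show "(\<phi> s has_derivative blinfun_apply (blinfun_scaleR_left (\<phi>x s x))) (at x within UNIV)"
      if "s \<in> {0..<T}" for s x
      using deriv_x[OF that] by (simp add: has_vector_derivative_def)
    have "continuous_on ({0..<T} \<times> UNIV) (\<lambda>z. blinfun_scaleR_left ((\<lambda>(s, x). \<phi>x s x) z))"
      by (intro bounded_linear.continuous_on[OF bounded_linear_blinfun_scaleR_left] continuous)
    thus "continuous (at (t, ?x) within {0..<T} \<times> UNIV) (\<lambda>(s, x). blinfun_scaleR_left (\<phi>x s x))"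
      using t by (simp add: continuous_on_eq_continuous_within case_prod_unfold)
  qed auto
  hence outer: "((\<lambda>(s, x). \<phi> s x) has_derivative
      (\<lambda>(hs, hx). hs *\<^sub>R \<phi>t t ?x + blinfun_apply (blinfun_scaleR_left (\<phi>x t ?x)) hx))
      (at (t, ?x) within (\<lambda>s. (s, y + c * s)) ` {0..<T})"
    by (rule has_derivative_subset) auto
  have inner: "((\<lambda>s. (s, y + c * s)) has_derivative (\<lambda>h. (h, c * h))) (at t within {0..<T})"
    by (auto intro!: derivative_eq_intros)
  from has_derivative_in_compose[OF inner outer]
  show ?thesis
    by (simp add: has_vector_derivative_def scaleR_conv_of_real algebra_simps)
qed

lemma integrable_with_coefficient:
  fixes w :: "real \<times> real \<Rightarrow> complex"
  assumes w: "w \<in> borel_measurable borel" "\<And>z. norm (w z) \<le> M"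
    and \<psi>: "continuous_on ({0..<T} \<times> UNIV) (\<lambda>(t, x). \<psi> t x)"
    and zero: "\<And>t x. t \<in> {0..<T} \<Longrightarrow> S \<le> t \<or> R < \<bar>x\<bar> \<Longrightarrow> \<psi> t x = 0"
  shows "integrable lborel (\<lambda>(t, x). indicator ({0..<T} \<times> UNIV) (t, x) *\<^sub>R (w (t, x) * \<psi> t x))"
proof -
  let ?B = "{0..S} \<times> {-R..R}"
  have "integrable lborel (\<lambda>z. w z * (indicator ?B z *\<^sub>R (\<lambda>(t, x). \<psi> t x) z))"
    by (rule integrable_mult_compact_support[OF w])
       (use S in \<open>auto intro!: compact_Times continuous_on_subset[OF \<psi>]\<close>)
  also have "(\<lambda>z. w z * (indicator ?B z *\<^sub>R (\<lambda>(t, x). \<psi> t x) z)) =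
      (\<lambda>(t, x). indicator ({0..<T} \<times> UNIV) (t, x) *\<^sub>R (w (t, x) * \<psi> t x))"
  proof (rule ext, clarify)
    fix t x
    show "w (t, x) * (indicator ?B (t, x) *\<^sub>R \<psi> t x) =
        indicator ({0..<T} \<times> UNIV) (t, x) *\<^sub>R (w (t, x) * \<psi> t x)"
    proof (cases "t \<in> {0..<T} \<and> (t, x) \<notin> ?B")
      case True
      have "\<psi> t x = 0" by (intro zero) (use True in \<open>auto simp: abs_if\<close>)
      thus ?thesis by simp
    qed (use S in \<open>auto simp: indicator_def\<close>)
  qed
  finally show ?thesis .
qed

section \<open>Transport along characteristics\<close>

lemma integral_along_characteristic:
  "(LINT t|lborel. indicator {0..<T} t *\<^sub>R (\<phi>t t (y + c * t) + of_real c * \<phi>x t (y + c * t)))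
     = - \<phi> 0 y"
proof -
  let ?d = "\<lambda>t. \<phi>t t (y + c * t) + of_real c * \<phi>x t (y + c * t)"
  have pull: "continuous_on {0..S} (\<lambda>t. \<psi> t (y + c * t))"
    if "continuous_on ({0..<T} \<times> UNIV) (\<lambda>(t, x). \<psi> t x)" for \<psi> :: "real \<Rightarrow> real \<Rightarrow> complex"
  proof -
    have "continuous_on {0..S} (\<lambda>t. (\<lambda>(t, x). \<psi> t x) (t, y + c * t))"
      by (rule continuous_on_compose2[OF that]) (use S in \<open>auto intro!: continuous_intros\<close>)
    thus ?thesis by simp
  qed
  have "set_integrable lborel {0..S} ?d"
    by (rule borel_integrable_atLeastAtMost'[OF continuous_on_add[OF pull[OF continuous(2)]
          continuous_on_mult[OF continuous_on_const pull[OF continuous(3)]]]])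
  note eq = set_borel_integral_eq_integral(2)[OF this]
  have "(?d has_integral \<phi> S (y + c * S) - \<phi> 0 (y + c * 0)) {0..S}"
  proof (rule fundamental_theorem_of_calculus[OF S(1)])
    show "((\<lambda>s. \<phi> s (y + c * s)) has_vector_derivative ?d t) (at t within {0..S})"
      if "t \<in> {0..S}" for t
      by (rule has_vector_derivative_within_subset[OF deriv_characteristic]) (use that S in auto)
  qed
  moreover have "\<phi> S (y + c * S) = 0" using vanish[of S] S by simp
  ultimately have "integral {0..S} ?d = - \<phi> 0 y" by (simp add: integral_unique)
  moreover have "indicator {0..<T} t *\<^sub>R ?d t = indicator {0..S} t *\<^sub>R ?d t" for t
    using vanish[of t "y + c * t"] S by (auto simp: indicator_def)
  ultimately show ?thesis using eq unfolding set_lebesgue_integral_def by (simp only:)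
qed

text \<open>The weight is constant along characteristics, so after the substitution $x = y + ct$ and Fubini's
  theorem only \<open>integral_along_characteristic\<close> has to be integrated against $e^{-|y|}$.\<close>

lemma transport_identity:
  "has_bochner_integral lborel
     (\<lambda>t. indicator {0..<T} t *\<^sub>R
        (LINT x|lborel. peak 1 (c * t) x * (\<phi>t t x + of_real c * \<phi>x t x)))
     (- (LINT x|lborel. peak 1 0 x * \<phi> 0 x))"
proof -
  let ?d = "\<lambda>t y. \<phi>t t (y + c * t) + of_real c * \<phi>x t (y + c * t)"
  let ?k = "\<lambda>t y. indicator {0..<T} t *\<^sub>R (peak 1 0 y * ?d t y)"
  (* The support box as seen in the moving frame. *)
  let ?B = "(\<lambda>(t, x). (t, x - c * t)) ` ({0..S} \<times> {-R..R})"
  have B: "compact ?B"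
    by (intro compact_continuous_image compact_Times)
       (auto simp: case_prod_unfold intro!: continuous_intros)
  have inB: "(t, y) \<in> ?B \<longleftrightarrow> t \<in> {0..S} \<and> y + c * t \<in> {-R..R}" for t y
  proof -
    have "(t, y) \<in> ?B" if "t \<in> {0..S}" "y + c * t \<in> {-R..R}"
      by (rule image_eqI[of _ _ "(t, y + c * t)"]) (use that in auto)
    thus ?thesis by auto
  qed
  have pull: "continuous_on ?B (\<lambda>z. \<psi> (fst z) (snd z + c * fst z))"
    if "continuous_on ({0..<T} \<times> UNIV) (\<lambda>(t, x). \<psi> t x)" for \<psi> :: "real \<Rightarrow> real \<Rightarrow> complex"
  proof -
    have "continuous_on ?B (\<lambda>z. (\<lambda>(t, x). \<psi> t x) (fst z, snd z + c * fst z))"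
      by (rule continuous_on_compose2[OF that]) (use S in \<open>auto intro!: continuous_intros\<close>)
    thus ?thesis by simp
  qed
  have w: "(\<lambda>z :: real \<times> real. peak 1 0 (snd z)) \<in> borel_measurable borel"
    unfolding peak_def by (intro borel_measurable_continuous_onI continuous_intros)
  have "continuous_on ?B (\<lambda>z. ?d (fst z) (snd z))"
    by (rule continuous_on_add[OF pull[OF continuous(2)]
          continuous_on_mult[OF continuous_on_const pull[OF continuous(3)]]])
  hence "integrable lborel (\<lambda>z. peak 1 0 (snd z) * (indicator ?B z *\<^sub>R ?d (fst z) (snd z)))"
    by (intro integrable_mult_compact_support[where M = 1, OF w _ B] peak_bounded(1)) simp
  also have "(\<lambda>z. peak 1 0 (snd z) * (indicator ?B z *\<^sub>R ?d (fst z) (snd z))) = (\<lambda>(t, y). ?k t y)"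
  proof (rule ext, clarify)
    fix t y
    show "peak 1 0 (snd (t, y)) * (indicator ?B (t, y) *\<^sub>R ?d (fst (t, y)) (snd (t, y))) = ?k t y"
    proof (cases "t \<in> {0..<T} \<and> (t, y) \<notin> ?B")
      case True
      have "\<phi> t (y + c * t) = 0 \<and> \<phi>t t (y + c * t) = 0 \<and> \<phi>x t (y + c * t) = 0"
        by (intro vanish) (use True inB[of t y] in \<open>auto simp: abs_if\<close>)
      thus ?thesis by simp
    next
      case False
      thus ?thesis using S inB[of t y] by (auto simp: indicator_def)
    qed
  qed
  finally have k: "integrable (lborel \<Otimes>\<^sub>M lborel) (\<lambda>(t, y). ?k t y)"
    by (simp add: lborel_prod)
  have slice: "(LINT y|lborel. ?k t y) = indicator {0..<T} t *\<^sub>R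
        (LINT x|lborel. peak 1 (c * t) x * (\<phi>t t x + of_real c * \<phi>x t x))" for t
  proof -
    have "(LINT x|lborel. peak 1 (c * t) x * (\<phi>t t x + of_real c * \<phi>x t x)) =
        (LINT y|lborel. peak 1 0 y * ?d t y)"
      using lborel_integral_real_affine[of 1
          "\<lambda>x. peak 1 (c * t) x * (\<phi>t t x + of_real c * \<phi>x t x)" "c * t"]
      by (simp add: peak_def add.commute)
    thus ?thesis by simp
  qed
  have "(LINT t|lborel. LINT y|lborel. ?k t y) = (LINT y|lborel. LINT t|lborel. ?k t y)"
    using lborel_pair.Fubini_integral[OF k] by simp
  also have "(\<lambda>y. LINT t|lborel. ?k t y) = (\<lambda>y. - (peak 1 0 y * \<phi> 0 y))"
  proof
    fix y
    have "(LINT t|lborel. ?k t y) = (LINT t|lborel. peak 1 0 y * (indicator {0..<T} t *\<^sub>R ?d t y))"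
      by simp
    also have "\<dots> = peak 1 0 y * (LINT t|lborel. indicator {0..<T} t *\<^sub>R ?d t y)"
      by (rule integral_mult_right_zero)
    finally show "(LINT t|lborel. ?k t y) = - (peak 1 0 y * \<phi> 0 y)"
      unfolding integral_along_characteristic by simp
  qed
  finally have "(LINT t|lborel. LINT y|lborel. ?k t y) = - (LINT x|lborel. peak 1 0 x * \<phi> 0 x)"
    by simp
  moreover have "integrable lborel (\<lambda>t. LINT y|lborel. ?k t y)"
    using lborel_pair.integrable_fst[OF k] .
  ultimately show ?thesis
    unfolding slice by (simp add: has_bochner_integral_iff)
qed

end

section \<open>Sobolev regularity of the peaked wave\<close>

definition wave_slope :: "complex \<Rightarrow> real \<Rightarrow> real \<Rightarrow> real \<Rightarrow> complex" where
  "wave_slope C1 c t x = - C1 * odd_peak 1 (c * t) x"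

lemma peaked_wave_eq_peak: "peaked_wave C1 c t x = C1 * peak 1 (c * t) x"
  by (simp add: peaked_wave_def peak_def)

lemma norm_wave:
  "norm (peaked_wave C1 c t x) = norm C1 * exp (- \<bar>x - c * t\<bar>)"
  "norm (wave_slope C1 c t x) = norm C1 * exp (- \<bar>x - c * t\<bar>)"
  by (simp_all add: peaked_wave_eq_peak wave_slope_def norm_mult norm_peak norm_odd_peak)

lemma wave_measurable [measurable]:
  "peaked_wave C1 c t \<in> borel_measurable borel" "wave_slope C1 c t \<in> borel_measurable borel"
proof -
  have "peaked_wave C1 c t = (\<lambda>x. C1 * peak 1 (c * t) x)"
    "wave_slope C1 c t = (\<lambda>x. - C1 * odd_peak 1 (c * t) x)"
    by (simp_all add: fun_eq_iff peaked_wave_eq_peak wave_slope_def)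
  thus "peaked_wave C1 c t \<in> borel_measurable borel" "wave_slope C1 c t \<in> borel_measurable borel"
    by simp_all
qed

lemma set_integrable_lebesgue_compact:
  fixes f :: "real \<Rightarrow> 'a::{banach, second_countable_topology}"
  assumes "integrable lborel f" "compact K" shows "set_integrable lebesgue K f"
  unfolding set_integrable_def
  using assms by (intro integrable_mult_indicator integrable_lebesgue) (auto simp: borel_compact)

lemma integrable_wave_powr:
  assumes "q > 0"
  shows "integrable lborel (\<lambda>x. norm (peaked_wave C1 c t x) powr q)"
    and "integrable lborel (\<lambda>x. norm (wave_slope C1 c t x) powr q)"
proof -
  have "(norm C1 * exp (- \<bar>x - c * t\<bar>)) powr q = norm C1 powr q * exp (- q * \<bar>x - c * t\<bar>)" for x
    by (simp add: powr_mult exp_powr_real mult.commute)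
  thus "integrable lborel (\<lambda>x. norm (peaked_wave C1 c t x) powr q)"
    and "integrable lborel (\<lambda>x. norm (wave_slope C1 c t x) powr q)"
    unfolding norm_wave by (simp_all add: integrable_exp_neg_abs[OF assms, simplified])
qed

lemma integrable_wave:
  "integrable lborel (peaked_wave C1 c t)" "integrable lborel (wave_slope C1 c t)"
proof -
  have "integrable lborel (\<lambda>x. norm (peaked_wave C1 c t x))"
    "integrable lborel (\<lambda>x. norm (wave_slope C1 c t x))"
    using integrable_wave_powr[of 1] by simp_all
  thus "integrable lborel (peaked_wave C1 c t)" "integrable lborel (wave_slope C1 c t)"
    by (simp_all add: integrable_norm_iff)
qed

lemma has_weak_deriv_wave: "has_weak_deriv (peaked_wave C1 c t) (wave_slope C1 c t)"
  unfolding has_weak_deriv_def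
proof (intro conjI allI impI)
  fix \<psi> assume "test_fun_line \<psi>"
  then obtain D K where D0: "D 0 = \<psi>" and D: "\<And>n x. (D n has_vector_derivative D (Suc n) x) (at x)"
    and K: "compact K" "\<And>x. x \<notin> K \<Longrightarrow> \<psi> x = 0"
    unfolding test_fun_line_def by blast
  obtain R where R: "\<And>x. x \<in> K \<Longrightarrow> norm x \<le> R"
    using compact_imp_bounded[OF K(1)] bounded_iff by blast
  have d: "(\<psi> has_vector_derivative D (Suc 0) x) (at x)" for x using D[of 0 x] by (simp add: D0)
  have cont: "continuous_on UNIV (D (Suc 0))"
    using has_vector_derivative_continuous[OF D] by (simp add: continuous_on_eq_continuous_at)
  have cont0: "continuous_on UNIV \<psi>"
    using has_vector_derivative_continuous[OF d] by (simp add: continuous_on_eq_continuous_at)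
  have z: "\<psi> x = 0" if "\<bar>x\<bar> > R" for x using K(2)[of x] R[of x] that by force
  note parts = peak_by_parts[where a = 1 and b = "c * t", OF _ d cont z, simplified]
  have meas [measurable]: "D (Suc 0) \<in> borel_measurable borel" "\<psi> \<in> borel_measurable borel"
    using borel_measurable_continuous_onI[OF cont] borel_measurable_continuous_onI[OF cont0] by auto
  have "(LINT x|lebesgue. peaked_wave C1 c t x * vector_derivative \<psi> (at x)) =
      (LINT x|lborel. C1 * (peak 1 (c * t) x * D (Suc 0) x))"
    by (subst integral_completion)
       (simp_all add: vector_derivative_at[OF d] peaked_wave_eq_peak mult.assoc)
  also have "\<dots> = C1 * (LINT x|lborel. odd_peak 1 (c * t) x * \<psi> x)"
    using parts(3) by simp
  also have "\<dots> = - (LINT x|lborel. - (C1 * (odd_peak 1 (c * t) x * \<psi> x)))" by simp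
  also have "\<dots> = - (LINT x|lebesgue. wave_slope C1 c t x * \<psi> x)"
    by (subst integral_completion) (simp_all add: wave_slope_def mult.assoc)
  finally show "(LINT x|lebesgue. peaked_wave C1 c t x * vector_derivative \<psi> (at x)) =
      - (LINT x|lebesgue. wave_slope C1 c t x * \<psi> x)" .
qed (intro set_integrable_lebesgue_compact integrable_wave; assumption)+

lemma wave_measurable_lebesgue:
  "peaked_wave C1 c t \<in> borel_measurable lebesgue" "wave_slope C1 c t \<in> borel_measurable lebesgue"
  by (intro measurable_completion; simp)+

lemma wave_in_W1_Lp:
  assumes "q > 0" shows "peaked_wave C1 c t \<in> W1 (Lp q)"
proof -
  have "peaked_wave C1 c t \<in> Lp q" "wave_slope C1 c t \<in> Lp q"
    using wave_measurable_lebesgue integrable_wave_powr[OF assms, THEN integrable_lebesgue]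
    by (simp_all add: Lp_def)
  thus ?thesis using has_weak_deriv_wave by (auto simp: W1_def)
qed

lemma norm_wave_le:
  "norm (peaked_wave C1 c t x) \<le> norm C1" "norm (wave_slope C1 c t x) \<le> norm C1"
  unfolding norm_wave by (simp_all add: mult_left_le)

lemma wave_in_W1_Linfty: "peaked_wave C1 c t \<in> W1 Linfty"
proof -
  have "peaked_wave C1 c t \<in> Linfty" "wave_slope C1 c t \<in> Linfty"
    unfolding Linfty_def
    by (auto intro!: wave_measurable_lebesgue exI[of _ "norm C1"] norm_wave_le)
  thus ?thesis using has_weak_deriv_wave by (auto simp: W1_def)
qed

lemma wave_jointly_measurable [measurable]:
  "(\<lambda>z. peak a (c * fst z) (snd z)) \<in> borel_measurable (borel :: (real \<times> real) measure)"
  "(\<lambda>z. odd_peak a (c * fst z) (snd z)) \<in> borel_measurable (borel :: (real \<times> real) measure)"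
proof -
  show 1: "(\<lambda>z. peak a (c * fst z) (snd z)) \<in> borel_measurable (borel :: (real \<times> real) measure)"
    unfolding peak_def by (intro borel_measurable_continuous_onI continuous_intros)
  have "{z :: real \<times> real. c * fst z \<le> snd z} \<in> sets borel"
    by (intro borel_closed closed_Collect_le continuous_intros)
  with 1 show "(\<lambda>z. odd_peak a (c * fst z) (snd z)) \<in> borel_measurable (borel :: (real \<times> real) measure)"
    unfolding odd_peak_def by (intro measurable_If) auto
qed

text \<open>The moduli of the wave and of its slope are bounded by \<open>norm C1\<close> at all times, which gives a bound on
  every compact set that is independent of the time.\<close>

lemma Linfty_loc_W13_loc_wave: "Linfty_loc_W13_loc T (peaked_wave C1 c) (wave_slope C1 c)"
  unfolding Linfty_loc_W13_loc_def
proof (intro conjI allI impI AE_I2)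
  have S: "({0..<T} \<times> UNIV :: (real \<times> real) set) \<in> sets borel"
    unfolding borel_prod[symmetric] by (intro pair_measureI) auto
  have "(\<lambda>z. indicator ({0..<T} \<times> UNIV) z *\<^sub>R (C1 * peak 1 (c * fst z) (snd z))) \<in> borel_measurable borel"
    "(\<lambda>z. indicator ({0..<T} \<times> UNIV) z *\<^sub>R (- C1 * odd_peak 1 (c * fst z) (snd z))) \<in> borel_measurable borel"
    using S by measurable
  thus "set_borel_measurable lebesgue ({0..<T} \<times> UNIV) (\<lambda>(t, x). peaked_wave C1 c t x)"
    "set_borel_measurable lebesgue ({0..<T} \<times> UNIV) (\<lambda>(t, x). wave_slope C1 c t x)"
    unfolding set_borel_measurable_def
    by (auto intro!: measurable_completion
        simp: case_prod_unfold peaked_wave_eq_peak wave_slope_def)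
  show "has_weak_deriv (peaked_wave C1 c t) (wave_slope C1 c t)" for t
    by (rule has_weak_deriv_wave)
next
  fix S and K :: "real set" assume K: "compact K"
  let ?w = "\<lambda>_. norm C1 powr 3"
  have i: "set_integrable lebesgue K (\<lambda>x. norm (peaked_wave C1 c t x) powr 3)"
    "set_integrable lebesgue K (\<lambda>x. norm (wave_slope C1 c t x) powr 3)" for t
    by (intro set_integrable_lebesgue_compact integrable_wave_powr K; simp)+
  have w: "set_integrable lebesgue K ?w"
    unfolding set_integrable_def
    by (rule integrable_lebesgue[OF borel_integrable_compact[OF K continuous_on_const]])
  have "(LINT x:K|lebesgue. norm (peaked_wave C1 c t x) powr 3) \<le> (LINT x:K|lebesgue. ?w x)"
    "(LINT x:K|lebesgue. norm (wave_slope C1 c t x) powr 3) \<le> (LINT x:K|lebesgue. ?w x)" for t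
    by (intro set_integral_mono i w powr_mono2 norm_wave_le; simp)+
  hence "(LINT x:K|lebesgue. norm (peaked_wave C1 c t x) powr 3) +
      (LINT x:K|lebesgue. norm (wave_slope C1 c t x) powr 3) \<le> 2 * (LINT x:K|lebesgue. ?w x)" for t
    unfolding mult_2 by (intro add_mono)
  with i show "\<exists>B. AE t in lebesgue. t \<in> {0..S} \<longrightarrow>
      set_integrable lebesgue K (\<lambda>x. norm (peaked_wave C1 c t x) powr 3) \<and>
      set_integrable lebesgue K (\<lambda>x. norm (wave_slope C1 c t x) powr 3) \<and>
      (LINT x:K|lebesgue. norm (peaked_wave C1 c t x) powr 3) +
      (LINT x:K|lebesgue. norm (wave_slope C1 c t x) powr 3) \<le> B"
    by (intro exI[of _ "2 * (LINT x:K|lebesgue. ?w x)"] AE_I2) blast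
qed

section \<open>The weak identity for the peaked wave\<close>

text \<open>The nonlocal terms are $\frac53 k_1 C_1^3 E_3 + \frac32 k_2 C_1^2 E_2$ and $-C_1^3 s E_3$, to which
  the convolution formulas with $a = 3$ and $a = 2$ apply.\<close>

lemma p_conv_wave:
  shows "has_bochner_integral lebesgue
      (\<lambda>y. kernel_p (x - y) *\<^sub>R nonlocal_term k1 k2 (peaked_wave C1 c t y) (wave_slope C1 c t y))
      (of_real k1 * C1 ^ 3 * 5 / 24 * (3 * peak 1 (c * t) x - peak 3 (c * t) x)
        + of_real k2 * C1\<^sup>2 / 2 * (2 * peak 1 (c * t) x - peak 2 (c * t) x))" (is ?A)
    and "has_bochner_integral lebesgue (\<lambda>y. kernel_p (x - y) *\<^sub>R (wave_slope C1 c t y) ^ 3)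
      (- (C1 ^ 3) / 8 * (odd_peak 1 (c * t) x - odd_peak 3 (c * t) x))" (is ?B)
proof -
  let ?b = "c * t" and ?K = "of_real k1 * C1 ^ 3 * 5 / 3" and ?L = "of_real k2 * C1\<^sup>2 * 3 / 2"
  have v2: "(wave_slope C1 c t y)\<^sup>2 = C1\<^sup>2 * peak 2 ?b y" for y
    using odd_peak_square[of 1 ?b y] by (simp add: wave_slope_def power_mult_distrib)
  have v3: "(wave_slope C1 c t y) ^ 3 = - (C1 ^ 3) * odd_peak 3 ?b y" for y
    using odd_peak_cube[of 1 ?b y] by (simp add: wave_slope_def power_mult_distrib)
  have "peak 1 ?b y * peak 2 ?b y = peak 3 ?b y" for y
    by (simp add: peak_def algebra_simps flip: exp_add of_real_mult)
  hence uv2: "C1 * peak 1 ?b y * (C1\<^sup>2 * peak 2 ?b y) = C1 ^ 3 * peak 3 ?b y" for y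
    by (metis mult.assoc mult.left_commute power2_eq_square power3_eq_cube)
  have u2: "(C1 * peak 1 ?b y)\<^sup>2 = C1\<^sup>2 * peak 2 ?b y"
    and u3: "(C1 * peak 1 ?b y) ^ 3 = C1 ^ 3 * peak 3 ?b y" for y
    using peak_power[of 1 ?b y 2] peak_power[of 1 ?b y 3] by (simp_all add: power_mult_distrib)
  have N: "nonlocal_term k1 k2 (peaked_wave C1 c t y) (wave_slope C1 c t y)
      = ?K * peak 3 ?b y + ?L * peak 2 ?b y" for y
    unfolding nonlocal_term_def v2 peaked_wave_eq_peak uv2 u2 u3 by (simp add: field_simps)
  have "has_bochner_integral lebesgue
      (\<lambda>y. ?K * (kernel_p (x - y) *\<^sub>R peak 3 ?b y) + ?L * (kernel_p (x - y) *\<^sub>R peak 2 ?b y))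
      (?K * (1 / (of_real 3 ^ 2 - 1) * (of_real 3 * peak 1 ?b x - peak 3 ?b x))
        + ?L * (1 / (of_real 2 ^ 2 - 1) * (of_real 2 * peak 1 ?b x - peak 2 ?b x)))"
    by (intro has_bochner_integral_add has_bochner_integral_mult_right p_conv_peak) auto
  moreover have "?K * (kernel_p (x - y) *\<^sub>R peak 3 ?b y) + ?L * (kernel_p (x - y) *\<^sub>R peak 2 ?b y)
      = kernel_p (x - y) *\<^sub>R (?K * peak 3 ?b y + ?L * peak 2 ?b y)" for y
    by (simp add: scaleR_conv_of_real algebra_simps)
  moreover have "?K * (1 / (of_real 3 ^ 2 - 1) * (of_real 3 * peak 1 ?b x - peak 3 ?b x))
        + ?L * (1 / (of_real 2 ^ 2 - 1) * (of_real 2 * peak 1 ?b x - peak 2 ?b x))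
      = of_real k1 * C1 ^ 3 * 5 / 24 * (3 * peak 1 ?b x - peak 3 ?b x)
        + of_real k2 * C1\<^sup>2 / 2 * (2 * peak 1 ?b x - peak 2 ?b x)"
    by (simp add: field_simps)
  ultimately show ?A unfolding N by (simp only:)
  have "has_bochner_integral lebesgue
      (\<lambda>y. - (C1 ^ 3) * (kernel_p (x - y) *\<^sub>R odd_peak 3 ?b y))
      (- (C1 ^ 3) * (1 / (of_real 3 ^ 2 - 1) * (odd_peak 1 ?b x - odd_peak 3 ?b x)))"
    by (intro has_bochner_integral_mult_right p_conv_odd_peak) auto
  thus ?B unfolding v3 by (simp add: scaleR_conv_of_real algebra_simps)
qed

text \<open>The flux and the source collect the coefficients of $\phi_x$ and $\phi$ in the weak identity, the
  convolution terms included. The $E_2$ part of $\frac14 k_2 u^2$ is cancelled by the one in the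
  convolution.\<close>

definition wave_flux :: "real \<Rightarrow> real \<Rightarrow> complex \<Rightarrow> real \<Rightarrow> real \<Rightarrow> real \<Rightarrow> complex" where
  "wave_flux k1 k2 C1 c t x =
     of_real k1 * C1 ^ 3 / 16 * (peak 3 (c * t) x + 5 * peak 1 (c * t) x)
       + of_real k2 * C1\<^sup>2 / 2 * peak 1 (c * t) x"

definition wave_source :: "real \<Rightarrow> complex \<Rightarrow> real \<Rightarrow> real \<Rightarrow> real \<Rightarrow> complex" where
  "wave_source k1 C1 c t x =
     of_real k1 * C1 ^ 3 / 48 * (9 * odd_peak 3 (c * t) x - odd_peak 1 (c * t) x)"

context box_supported
begin

lemma weak_integrand_wave:
  assumes t: "t \<in> {0..<T}"
  shows "weak_integrand k1 k2 T (peaked_wave C1 c) (wave_slope C1 c) \<phi> t x =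
     peaked_wave C1 c t x * \<phi>t t x - wave_flux k1 k2 C1 c t x * \<phi>x t x
       + wave_source k1 C1 c t x * \<phi> t x"
proof -
  let ?b = "c * t"
  have u2: "(peaked_wave C1 c t x)\<^sup>2 = C1\<^sup>2 * peak 2 ?b x"
    using peak_power[of 1 ?b x 2] by (simp add: peaked_wave_eq_peak power_mult_distrib)
  have u3: "(peaked_wave C1 c t x) ^ 3 = C1 ^ 3 * peak 3 ?b x"
    using peak_power[of 1 ?b x 3] by (simp add: peaked_wave_eq_peak power_mult_distrib)
  have v3: "(wave_slope C1 c t x) ^ 3 = - (C1 ^ 3) * odd_peak 3 ?b x"
    using odd_peak_cube[of 1 ?b x] by (simp add: wave_slope_def power_mult_distrib)
  note P = p_conv_wave[THEN has_bochner_integral_integral_eq, folded p_conv_def]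
  show ?thesis
    unfolding weak_integrand_def Let_def vector_derivative_time[OF t] vector_derivative_space[OF t]
      u2 u3 v3 P wave_flux_def wave_source_def
    by (simp add: field_simps)
qed

text \<open>The coefficients of \<open>weak_integrand_wave\<close> are bounded, and the test function has compact support.\<close>

lemma set_integrable_weak_integrand_wave:
  "set_integrable lebesgue ({0..<T} \<times> UNIV)
     (\<lambda>(t, x). weak_integrand k1 k2 T (peaked_wave C1 c) (wave_slope C1 c) \<phi> t x)"
proof -
  let ?Q = "{0..<T} \<times> (UNIV :: real set)"
  let ?M = "norm C1 + norm (of_real k1 * C1 ^ 3 / 16) * 6 + norm (of_real k2 * C1\<^sup>2 / 2)
    + norm (of_real k1 * C1 ^ 3 / 48) * 10"
  have nonneg: "0 \<le> norm C1" "0 \<le> norm (of_real k1 * C1 ^ 3 / 16)"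
    "0 \<le> norm (of_real k2 * C1\<^sup>2 / 2)" "0 \<le> norm (of_real k1 * C1 ^ 3 / 48)"
    by (rule norm_ge_zero)+
  have p: "norm (peak a b x) \<le> 1" "norm (odd_peak a b x) \<le> 1" if "a \<ge> 0" for a b x
    using peak_bounded[OF that] .
  have p5: "norm (peak 3 b x + 5 * peak 1 b x) \<le> 6" for b x
    using norm_triangle_ineq[of "peak 3 b x" "5 * peak 1 b x"] p(1)[of 3 b x] p(1)[of 1 b x]
    by (simp add: norm_mult)
  have o9: "norm (9 * odd_peak 3 b x - odd_peak 1 b x) \<le> 10" for b x
    using norm_triangle_ineq4[of "9 * odd_peak 3 b x" "odd_peak 1 b x"] p(2)[of 3 b x] p(2)[of 1 b x]
    by (simp add: norm_mult)
  have G: "norm (wave_flux k1 k2 C1 c t x) \<le> ?M" for t x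
  proof -
    have "norm (wave_flux k1 k2 C1 c t x) \<le>
        norm (of_real k1 * C1 ^ 3 / 16) * 6 + norm (of_real k2 * C1\<^sup>2 / 2) * 1"
      unfolding wave_flux_def
      by (intro norm_triangle_mono; subst norm_mult; intro mult_left_mono p p5) auto
    also have "\<dots> \<le> ?M"
      using nonneg by linarith
    finally show ?thesis .
  qed
  have H: "norm (wave_source k1 C1 c t x) \<le> ?M" for t x
  proof -
    have "norm (wave_source k1 C1 c t x) \<le> norm (of_real k1 * C1 ^ 3 / 48) * 10"
      unfolding wave_source_def by (subst norm_mult, intro mult_left_mono o9) auto
    also have "\<dots> \<le> ?M"
      using nonneg by linarith
    finally show ?thesis .
  qed
  have U: "norm (peaked_wave C1 c t x) \<le> ?M" for t x
    by (rule order_trans[OF norm_wave_le(1)]) (use nonneg in linarith)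
  have meas: "(\<lambda>z. peaked_wave C1 c (fst z) (snd z)) \<in> borel_measurable (borel :: (real \<times> real) measure)"
    "(\<lambda>z. wave_flux k1 k2 C1 c (fst z) (snd z)) \<in> borel_measurable (borel :: (real \<times> real) measure)"
    "(\<lambda>z. wave_source k1 C1 c (fst z) (snd z)) \<in> borel_measurable (borel :: (real \<times> real) measure)"
    unfolding peaked_wave_eq_peak wave_flux_def wave_source_def
    by (intro borel_measurable_add borel_measurable_diff borel_measurable_times
         borel_measurable_const wave_jointly_measurable)+
  note I = integrable_with_coefficient[OF meas(1) U continuous(2)]
    integrable_with_coefficient[OF meas(2) G continuous(3)]
    integrable_with_coefficient[OF meas(3) H continuous(1)]
  have "integrable lborel (\<lambda>z.
      (\<lambda>(t, x). indicator ?Q (t, x) *\<^sub>R (peaked_wave C1 c (fst (t, x)) (snd (t, x)) * \<phi>t t x)) z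
      - (\<lambda>(t, x). indicator ?Q (t, x) *\<^sub>R (wave_flux k1 k2 C1 c (fst (t, x)) (snd (t, x)) * \<phi>x t x)) z
      + (\<lambda>(t, x). indicator ?Q (t, x) *\<^sub>R (wave_source k1 C1 c (fst (t, x)) (snd (t, x)) * \<phi> t x)) z)"
    by (intro Bochner_Integration.integrable_add Bochner_Integration.integrable_diff I)
       (use vanish in blast)+
  also have "(\<lambda>z.
      (\<lambda>(t, x). indicator ?Q (t, x) *\<^sub>R (peaked_wave C1 c (fst (t, x)) (snd (t, x)) * \<phi>t t x)) z
      - (\<lambda>(t, x). indicator ?Q (t, x) *\<^sub>R (wave_flux k1 k2 C1 c (fst (t, x)) (snd (t, x)) * \<phi>x t x)) z
      + (\<lambda>(t, x). indicator ?Q (t, x) *\<^sub>R (wave_source k1 C1 c (fst (t, x)) (snd (t, x)) * \<phi> t x)) z)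
    = (\<lambda>z. indicator ?Q z *\<^sub>R
        (\<lambda>(t, x). weak_integrand k1 k2 T (peaked_wave C1 c) (wave_slope C1 c) \<phi> t x) z)"
    by (auto simp: fun_eq_iff indicator_def weak_integrand_wave)
  finally show ?thesis
    unfolding set_integrable_def by (rule integrable_lebesgue)
qed

text \<open>After integration by parts the $s E_3$ terms of the flux and of the source cancel, and the algebraic
  condition on \<open>C1\<close> makes the rest equal to that of a wave transported with speed \<open>c\<close>.\<close>

lemma integral_weak_integrand_wave:
  assumes t: "t \<in> {0..<T}"
    and C1: "1/3 * of_real k1 * C1\<^sup>2 + 1/2 * of_real k2 * C1 + of_real c = 0"
  shows "(LINT x|lebesgue. weak_integrand k1 k2 T (peaked_wave C1 c) (wave_slope C1 c) \<phi> t x)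
     = C1 * (LINT x|lborel. peak 1 (c * t) x * (\<phi>t t x + of_real c * \<phi>x t x))"
proof -
  let ?b = "c * t"
  let ?J = "LINT x|lborel. peak 1 ?b x * \<phi>t t x"
  let ?O = "\<lambda>a. LINT x|lborel. odd_peak a ?b x * \<phi> t x"
  have zero: "\<phi> t x = 0" if "\<bar>x\<bar> > R" for x using vanish[OF t, of x] that by simp
  note parts = peak_by_parts[OF _ deriv_x[OF t] continuous_slice[OF continuous(3) t] zero]
  have x: "has_bochner_integral lborel (\<lambda>x. peak a ?b x * \<phi>x t x) (of_real a * ?O a)"
    and o: "has_bochner_integral lborel (\<lambda>x. odd_peak a ?b x * \<phi> t x) (?O a)" if "a > 0" for a
    using parts[OF that] by (simp_all add: has_bochner_integral_iff)
  have "\<phi>t t = (\<lambda>x. indicator {-R..R} x *\<^sub>R \<phi>t t x)"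
    using vanish[OF t] by (fastforce simp: fun_eq_iff indicator_def abs_le_iff not_le)
  moreover have "integrable lborel (\<lambda>x. peak 1 ?b x * (indicator {-R..R} x *\<^sub>R \<phi>t t x))"
    by (rule integrable_mult_compact_support[where M = 1])
       (auto intro: peak_bounded continuous_on_subset[OF continuous_slice[OF continuous(2) t]])
  ultimately have \<tau>: "has_bochner_integral lborel (\<lambda>x. peak 1 ?b x * \<phi>t t x) ?J"
    by (metis has_bochner_integral_integrable)
  let ?K = "of_real k1 * C1 ^ 3" and ?L = "of_real k2 * C1\<^sup>2"
  have "has_bochner_integral lborel
      (\<lambda>x. C1 * (peak 1 ?b x * \<phi>t t x) - ?K / 16 * (peak 3 ?b x * \<phi>x t x)
         - (5 * ?K / 16 + ?L / 2) * (peak 1 ?b x * \<phi>x t x)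
         + 9 * ?K / 48 * (odd_peak 3 ?b x * \<phi> t x) - ?K / 48 * (odd_peak 1 ?b x * \<phi> t x))
      (C1 * ?J - ?K / 16 * (of_real 3 * ?O 3) - (5 * ?K / 16 + ?L / 2) * (of_real 1 * ?O 1)
         + 9 * ?K / 48 * ?O 3 - ?K / 48 * ?O 1)"
    by (intro has_bochner_integral_add has_bochner_integral_diff has_bochner_integral_mult_right \<tau> x o)
       auto
  moreover have "C1 * (peak 1 ?b x * \<phi>t t x) - ?K / 16 * (peak 3 ?b x * \<phi>x t x)
         - (5 * ?K / 16 + ?L / 2) * (peak 1 ?b x * \<phi>x t x)
         + 9 * ?K / 48 * (odd_peak 3 ?b x * \<phi> t x) - ?K / 48 * (odd_peak 1 ?b x * \<phi> t x)
      = weak_integrand k1 k2 T (peaked_wave C1 c) (wave_slope C1 c) \<phi> t x" for x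
    unfolding weak_integrand_wave[OF t] wave_flux_def wave_source_def peaked_wave_eq_peak
    by (simp add: field_simps)
  ultimately have "has_bochner_integral lebesgue
      (\<lambda>x. weak_integrand k1 k2 T (peaked_wave C1 c) (wave_slope C1 c) \<phi> t x)
      (C1 * ?J - ?K / 16 * (of_real 3 * ?O 3) - (5 * ?K / 16 + ?L / 2) * (of_real 1 * ?O 1)
         + 9 * ?K / 48 * ?O 3 - ?K / 48 * ?O 1)"
    by (intro has_bochner_integral_lebesgue) simp
  hence "(LINT x|lebesgue. weak_integrand k1 k2 T (peaked_wave C1 c) (wave_slope C1 c) \<phi> t x) =
      C1 * ?J - (?K / 3 + ?L / 2) * ?O 1"
    by (subst has_bochner_integral_integral_eq) (assumption, simp add: field_simps)
  moreover have "?K / 3 + ?L / 2 = - C1 * of_real c"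
  proof -
    have "?K / 3 + ?L / 2 + C1 * of_real c =
        C1 * (1/3 * of_real k1 * C1\<^sup>2 + 1/2 * of_real k2 * C1 + of_real c)"
      by (simp add: field_simps power2_eq_square power3_eq_cube)
    thus ?thesis using C1 by (simp add: eq_neg_iff_add_eq_0)
  qed
  moreover have "(LINT x|lborel. peak 1 ?b x * (\<phi>t t x + of_real c * \<phi>x t x)) = ?J + of_real c * ?O 1"
  proof -
    have "has_bochner_integral lborel
        (\<lambda>x. peak 1 ?b x * \<phi>t t x + of_real c * (peak 1 ?b x * \<phi>x t x)) (?J + of_real c * (of_real 1 * ?O 1))"
      by (intro has_bochner_integral_add has_bochner_integral_mult_right \<tau> x) auto
    thus ?thesis by (simp add: has_bochner_integral_iff algebra_simps)
  qed
  ultimately show ?thesis by (simp add: algebra_simps)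
qed

lemma weak_identity_wave:
  assumes C1: "1/3 * of_real k1 * C1\<^sup>2 + 1/2 * of_real k2 * C1 + of_real c = 0"
  shows "(LINT t:{0..<T}|lebesgue. LINT x|lebesgue.
       weak_integrand k1 k2 T (peaked_wave C1 c) (wave_slope C1 c) \<phi> t x)
     + (LINT x|lebesgue. peaked_wave C1 c 0 x * \<phi> 0 x) = 0"
proof -
  let ?A = "\<lambda>t. indicator {0..<T} t *\<^sub>R
    (LINT x|lborel. peak 1 (c * t) x * (\<phi>t t x + of_real c * \<phi>x t x))"
  have "(LINT t:{0..<T}|lebesgue. LINT x|lebesgue.
      weak_integrand k1 k2 T (peaked_wave C1 c) (wave_slope C1 c) \<phi> t x) = (LINT t|lebesgue. C1 * ?A t)"
    unfolding set_lebesgue_integral_def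
    by (rule Bochner_Integration.integral_cong)
       (auto simp: indicator_def integral_weak_integrand_wave[OF _ C1])
  also have "\<dots> = C1 * (- (LINT x|lborel. peak 1 0 x * \<phi> 0 x))"
    by (intro has_bochner_integral_integral_eq has_bochner_integral_mult_right
         has_bochner_integral_lebesgue transport_identity)
  also have "\<dots> = - (LINT x|lborel. peaked_wave C1 c 0 x * \<phi> 0 x)"
    by (simp add: peaked_wave_eq_peak mult.assoc)
  also have "\<dots> = - (LINT x|lebesgue. peaked_wave C1 c 0 x * \<phi> 0 x)"
  proof -
    have [measurable]: "\<phi> 0 \<in> borel_measurable borel"
      using continuous_slice[OF continuous(1), of 0] S by (intro borel_measurable_continuous_onI) auto
    show ?thesis by (subst integral_completion) simp_all
  qed
  finally show ?thesis by simp
qed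

end

theorem theorem5p1:
  fixes k1 k2 c :: real and C1 :: complex
  assumes "1/3 * of_real k1 * C1\<^sup>2 + 1/2 * of_real k2 * C1 + of_real c = 0"
  shows "global_weak_solution k1 k2 (peaked_wave C1 c 0) (peaked_wave C1 c) \<and>
         (\<forall>t\<ge>0. peaked_wave C1 c t \<in> W1 (Lp 2) \<inter> W1 Linfty)"
proof (intro conjI allI impI)
  show "global_weak_solution k1 k2 (peaked_wave C1 c 0) (peaked_wave C1 c)"
    unfolding global_weak_solution_def weak_solution_def
  proof (intro allI impI conjI exI[of _ "wave_slope C1 c"] AE_I2)
    fix T :: real and \<phi> assume T: "0 < T" and "test_fun T \<phi>"
    then obtain S R \<phi>t \<phi>x where "box_supported T S R \<phi> \<phi>t \<phi>x"
      using test_fun_imp_box_supported by blast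
    then interpret box_supported T S R \<phi> \<phi>t \<phi>x .
    show "set_integrable lebesgue ({0..<T} \<times> UNIV)
        (\<lambda>(t, x). weak_integrand k1 k2 T (peaked_wave C1 c) (wave_slope C1 c) \<phi> t x)"
      by (rule set_integrable_weak_integrand_wave)
    show "(LINT t:{0..<T}|lebesgue. LINT x|lebesgue.
          weak_integrand k1 k2 T (peaked_wave C1 c) (wave_slope C1 c) \<phi> t x)
        + (LINT x|lebesgue. peaked_wave C1 c 0 x * \<phi> 0 x) = 0"
      by (rule weak_identity_wave[OF assms])
  next
    fix t x
    show "p_conv_exists (\<lambda>y. nonlocal_term k1 k2 (peaked_wave C1 c t y) (wave_slope C1 c t y)) x"
      "p_conv_exists (\<lambda>y. (wave_slope C1 c t y) ^ 3) x"
      unfolding p_conv_exists_def using p_conv_wave by (simp_all add: has_bochner_integral_iff)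
  qed (simp_all add: wave_in_W1_Lp Linfty_loc_W13_loc_wave)
  show "peaked_wave C1 c t \<in> W1 (Lp 2) \<inter> W1 Linfty" for t
    by (simp add: wave_in_W1_Lp wave_in_W1_Linfty)
qed

end
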